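(* Let $R$ be a ring which is not left pure semisimple and let $\lambda>|R|$ be a regular cardinal of the form $\lambda=(\mu^{\aleph_0})^+$ for some cardinal $\mu$. Then there are $R$-modules $M$, $M_1$ and $M_2$ of cardinality $\lambda$ such that: (i) $M\oplus M_1\cong M\oplus M_2$; (ii) $M_1\not\cong M_2$.
   Context: Rings are associative with unit $1$, not necessarily commutative or Noetherian. An $R$-module is a left $R$-module, and $\cong$ is isomorphism of $R$-modules. $\kappa^+$ denotes the successor cardinal of $\kappa$. A ring $R$ is left pure semisimple if every left $R$-module is pure-injective (equivalently, every left $R$-module is a direct sum of indecomposable modules). The statement is in ZFC. *)

theory Defs
  imports "HOL-Algebra.Module"
begin

unbundle cardinal_syntax

text \<open>
  HOL-Algebra's locale \<open>module\<close> requires a commutative ring of scalars; the locale below has the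
  same axioms over an arbitrary (associative, unital) ring. As with \<open>module\<close>, the fields
  \<open>mult\<close> and \<open>one\<close> of the record carrying the module play no role.
\<close>

locale left_module = R?: ring R + M?: abelian_group M for R (structure) and M (structure) +
  assumes smult_closed [simp, intro]:
      "\<lbrakk>a \<in> carrier R; x \<in> carrier M\<rbrakk> \<Longrightarrow> a \<odot>\<^bsub>M\<^esub> x \<in> carrier M"
    and smult_l_distr:
      "\<lbrakk>a \<in> carrier R; b \<in> carrier R; x \<in> carrier M\<rbrakk> \<Longrightarrow>
        (a \<oplus>\<^bsub>R\<^esub> b) \<odot>\<^bsub>M\<^esub> x = a \<odot>\<^bsub>M\<^esub> x \<oplus>\<^bsub>M\<^esub> b \<odot>\<^bsub>M\<^esub> x"
    and smult_r_distr:
      "\<lbrakk>a \<in> carrier R; x \<in> carrier M; y \<in> carrier M\<rbrakk> \<Longrightarrow>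
        a \<odot>\<^bsub>M\<^esub> (x \<oplus>\<^bsub>M\<^esub> y) = a \<odot>\<^bsub>M\<^esub> x \<oplus>\<^bsub>M\<^esub> a \<odot>\<^bsub>M\<^esub> y"
    and smult_assoc1:
      "\<lbrakk>a \<in> carrier R; b \<in> carrier R; x \<in> carrier M\<rbrakk> \<Longrightarrow>
        (a \<otimes>\<^bsub>R\<^esub> b) \<odot>\<^bsub>M\<^esub> x = a \<odot>\<^bsub>M\<^esub> (b \<odot>\<^bsub>M\<^esub> x)"
    and smult_one [simp]:
      "x \<in> carrier M \<Longrightarrow> \<one>\<^bsub>R\<^esub> \<odot>\<^bsub>M\<^esub> x = x"

definition module_hom ::
  "('r, 'x) ring_scheme \<Rightarrow> ('r, 'a) module \<Rightarrow> ('r, 'b) module \<Rightarrow> ('a \<Rightarrow> 'b) set" where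
  "module_hom R M N =
    {h. h \<in> carrier M \<rightarrow> carrier N \<and>
        (\<forall>x\<in>carrier M. \<forall>y\<in>carrier M. h (x \<oplus>\<^bsub>M\<^esub> y) = h x \<oplus>\<^bsub>N\<^esub> h y) \<and>
        (\<forall>r\<in>carrier R. \<forall>x\<in>carrier M. h (r \<odot>\<^bsub>M\<^esub> x) = r \<odot>\<^bsub>N\<^esub> h x)}"

definition module_iso ::
  "('r, 'x) ring_scheme \<Rightarrow> ('r, 'a) module \<Rightarrow> ('r, 'b) module \<Rightarrow> bool" where
  "module_iso R M N \<longleftrightarrow> (\<exists>h \<in> module_hom R M N. bij_betw h (carrier M) (carrier N))"

definition direct_sum ::
  "('r, 'a) module \<Rightarrow> ('r, 'b) module \<Rightarrow> ('r, 'a \<times> 'b) module" where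
  "direct_sum M N =
    \<lparr>carrier = carrier M \<times> carrier N, mult = undefined, one = undefined,
     zero = (\<zero>\<^bsub>M\<^esub>, \<zero>\<^bsub>N\<^esub>),
     add = (\<lambda>(x, y) (x', y'). (x \<oplus>\<^bsub>M\<^esub> x', y \<oplus>\<^bsub>N\<^esub> y')),
     smult = (\<lambda>r (x, y). (r \<odot>\<^bsub>M\<^esub> x, r \<odot>\<^bsub>N\<^esub> y))\<rparr>"

text \<open>
  A submodule \<open>A\<close> of \<open>B\<close> is pure if every finite system of linear equations
  \<open>\<Sum>\<^sub>j r\<^sub>i\<^sub>j x\<^sub>j = a\<^sub>i\<close> with \<open>r\<^sub>i\<^sub>j \<in> R\<close> and \<open>a\<^sub>i \<in> A\<close>
  that is solvable in \<open>B\<close> is solvable in \<open>A\<close>.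
\<close>

definition pure_submodule ::
  "'b set \<Rightarrow> ('r, 'x) ring_scheme \<Rightarrow> ('r, 'b) module \<Rightarrow> bool" where
  "pure_submodule A R B \<longleftrightarrow> submodule A R B \<and>
    (\<forall>(m::nat) (n::nat) r a.
      (\<forall>i<m. \<forall>j<n. r i j \<in> carrier R) \<longrightarrow> (\<forall>i<m. a i \<in> A) \<longrightarrow>
      (\<exists>x. (\<forall>j<n. x j \<in> carrier B) \<and>
           (\<forall>i<m. (\<Oplus>\<^bsub>B\<^esub>j\<in>{..<n}. r i j \<odot>\<^bsub>B\<^esub> x j) = a i)) \<longrightarrow>
      (\<exists>x. (\<forall>j<n. x j \<in> A) \<and>
           (\<forall>i<m. (\<Oplus>\<^bsub>B\<^esub>j\<in>{..<n}. r i j \<odot>\<^bsub>B\<^esub> x j) = a i)))"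

text \<open>
  Pure-injectivity (every homomorphism to \<open>N\<close> from a pure submodule \<open>A\<close> of a module \<open>B\<close>
  extends to \<open>B\<close>) quantifies over all modules \<open>B\<close>, and pure semisimplicity over all modules
  \<open>N\<close>. A HOL formula cannot quantify over types, so the types \<open>'b\<close> and \<open>'n\<close> that host the
  carriers of \<open>B\<close> and \<open>N\<close> are parameters. The mathematical notions are ``for all types
  \<open>'n\<close>, \<open>'b\<close>''; their negation is ``for some types \<open>'n\<close>, \<open>'b\<close>'', so that a theorem
  with hypothesis \<open>\<not> left_pure_semisimple TYPE('n) TYPE('b) R\<close> for free type variables \<open>'n\<close>
  and \<open>'b\<close> applies to every ring which is not left pure semisimple.
\<close>

definition pure_injective ::
  "'b itself \<Rightarrow> ('r, 'x) ring_scheme \<Rightarrow> ('r, 'n) module \<Rightarrow> bool" where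
  "pure_injective _ R N \<longleftrightarrow> left_module R N \<and>
    (\<forall>(B :: ('r, 'b) module) A f.
      left_module R B \<longrightarrow> pure_submodule A R B \<longrightarrow> f \<in> module_hom R (B\<lparr>carrier := A\<rparr>) N \<longrightarrow>
      (\<exists>g \<in> module_hom R B N. \<forall>x\<in>A. g x = f x))"

definition left_pure_semisimple ::
  "'n itself \<Rightarrow> 'b itself \<Rightarrow> ('r, 'x) ring_scheme \<Rightarrow> bool" where
  "left_pure_semisimple _ _ R \<longleftrightarrow>
    (\<forall>N :: ('r, 'n) module. left_module R N \<longrightarrow> pure_injective TYPE('b) R N)"

lemma left_module_direct_sum:
  assumes "left_module R M" "left_module R N"
  shows "left_module R (direct_sum M N)"
proof -
  interpret M: left_module R M by fact
  interpret N: left_module R N by fact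
  have "abelian_group (direct_sum M N)"
  proof (rule abelian_groupI)
    fix p assume "p \<in> carrier (direct_sum M N)"
    then obtain x y where p: "p = (x, y)" "x \<in> carrier M" "y \<in> carrier N"
      by (auto simp: direct_sum_def)
    show "\<exists>q\<in>carrier (direct_sum M N). q \<oplus>\<^bsub>direct_sum M N\<^esub> p = \<zero>\<^bsub>direct_sum M N\<^esub>"
      using p by (intro bexI[of _ "(\<ominus>\<^bsub>M\<^esub> x, \<ominus>\<^bsub>N\<^esub> y)"])
        (auto simp: direct_sum_def M.M.l_neg N.M.l_neg)
  qed (auto simp: direct_sum_def M.M.a_ac N.M.a_ac)
  then show ?thesis
    by (intro left_module.intro left_module_axioms.intro M.R.ring_axioms)
      (auto simp: direct_sum_def M.smult_l_distr N.smult_l_distr M.smult_r_distr N.smult_r_distr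
        M.smult_assoc1 N.smult_assoc1)
qed

end

theory Submission
  imports Defs "HOL-Algebra.Free_Abelian_Groups"
begin

text \<open>
  The module \<open>M\<close> may absorb the difference between \<open>M\<^sub>1\<close> and \<open>M\<^sub>2\<close>, so the theorem reduces to finding
  two non-isomorphic modules of cardinality \<open>\<lambda>\<close>. Let \<open>I\<close> be a left ideal, \<open>Q = R/I\<close> and \<open>F\<close> the free module
  of rank \<open>\<lambda>\<close>. For \<open>M\<^sub>1 = F\<close>, \<open>M\<^sub>2 = Q \<oplus> F\<close> and \<open>M\<close> the direct sum of \<open>F\<close> with countably many copies
  of \<open>Q\<close>, one has \<open>M \<oplus> M\<^sub>1 \<cong> M \<oplus> M\<^sub>2\<close> (Eilenberg swindle). If \<open>F \<cong> Q \<oplus> F\<close>, then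
  \<open>Q\<close> is projective, so \<open>I\<close> is generated by an idempotent. If every left ideal is of this kind, then
  every module is injective by Baer's criterion, and \<open>R\<close> is left pure semisimple. Finally \<open>\<lambda>\<close>
  is infinite: \<open>2 \<le> |R| \<le> \<mu>\<^sup>\<omega>\<close> forces \<open>\<mu> \<ge> 2\<close>.
\<close>

section \<open>Modules over an arbitrary ring: submodules, homomorphisms, isomorphisms\<close>

lemma (in left_module) smult_l_null [simp]:
  assumes "x \<in> carrier M"
  shows "\<zero>\<^bsub>R\<^esub> \<odot>\<^bsub>M\<^esub> x = \<zero>\<^bsub>M\<^esub>"
  using smult_l_distr[of "\<zero>\<^bsub>R\<^esub>" "\<zero>\<^bsub>R\<^esub>" x] assms by simp

lemma (in left_module) smult_r_null [simp]:
  assumes "a \<in> carrier R"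
  shows "a \<odot>\<^bsub>M\<^esub> \<zero>\<^bsub>M\<^esub> = \<zero>\<^bsub>M\<^esub>"
  using smult_r_distr[of a "\<zero>\<^bsub>M\<^esub>" "\<zero>\<^bsub>M\<^esub>"] assms by simp

lemma (in left_module) smult_l_minus:
  assumes "a \<in> carrier R" "x \<in> carrier M"
  shows "(\<ominus>\<^bsub>R\<^esub> a) \<odot>\<^bsub>M\<^esub> x = \<ominus>\<^bsub>M\<^esub> (a \<odot>\<^bsub>M\<^esub> x)"
  using smult_l_distr[of "\<ominus>\<^bsub>R\<^esub> a" a x] assms by (simp add: R.l_neg M.minus_equality)

text \<open>Closure under negatives, which \<open>submodule\<close> demands, comes from closure
  under scalars: negatives are the multiples by -1.\<close>

lemma (in left_module) submoduleI:
  assumes "H \<subseteq> carrier M" "\<zero>\<^bsub>M\<^esub> \<in> H"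
    and "\<And>x y. \<lbrakk>x \<in> H; y \<in> H\<rbrakk> \<Longrightarrow> x \<oplus>\<^bsub>M\<^esub> y \<in> H"
    and smult: "\<And>a x. \<lbrakk>a \<in> carrier R; x \<in> H\<rbrakk> \<Longrightarrow> a \<odot>\<^bsub>M\<^esub> x \<in> H"
  shows "submodule H R M"
proof -
  have "\<ominus>\<^bsub>M\<^esub> x \<in> H" if "x \<in> H" for x
    using smult[of "\<ominus>\<^bsub>R\<^esub> \<one>\<^bsub>R\<^esub>" x] that assms(1) smult_l_minus[of "\<one>\<^bsub>R\<^esub>" x] by auto
  then show ?thesis
    using assms by unfold_locales (auto simp flip: a_inv_def)
qed

lemma submoduleD:
  assumes "submodule H R M"
  shows "H \<subseteq> carrier M" "\<zero>\<^bsub>M\<^esub> \<in> H"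
    and "\<lbrakk>x \<in> H; y \<in> H\<rbrakk> \<Longrightarrow> x \<oplus>\<^bsub>M\<^esub> y \<in> H" and "x \<in> H \<Longrightarrow> \<ominus>\<^bsub>M\<^esub> x \<in> H"
    and "\<lbrakk>a \<in> carrier R; x \<in> H\<rbrakk> \<Longrightarrow> a \<odot>\<^bsub>M\<^esub> x \<in> H"
proof -
  interpret submodule H R M by fact
  show "H \<subseteq> carrier M" "\<zero>\<^bsub>M\<^esub> \<in> H"
    and "\<lbrakk>x \<in> H; y \<in> H\<rbrakk> \<Longrightarrow> x \<oplus>\<^bsub>M\<^esub> y \<in> H" and "x \<in> H \<Longrightarrow> \<ominus>\<^bsub>M\<^esub> x \<in> H"
    and "\<lbrakk>a \<in> carrier R; x \<in> H\<rbrakk> \<Longrightarrow> a \<odot>\<^bsub>M\<^esub> x \<in> H"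
    using subset one_closed m_closed m_inv_closed by (auto simp: a_inv_def)
qed

lemma module_homD:
  assumes "h \<in> module_hom R M N"
  shows "x \<in> carrier M \<Longrightarrow> h x \<in> carrier N"
    and "\<lbrakk>x \<in> carrier M; y \<in> carrier M\<rbrakk> \<Longrightarrow> h (x \<oplus>\<^bsub>M\<^esub> y) = h x \<oplus>\<^bsub>N\<^esub> h y"
    and "\<lbrakk>r \<in> carrier R; x \<in> carrier M\<rbrakk> \<Longrightarrow> h (r \<odot>\<^bsub>M\<^esub> x) = r \<odot>\<^bsub>N\<^esub> h x"
  using assms by (auto simp: module_hom_def)

lemma module_hom_zero:
  assumes "left_module R M" "left_module R N" "h \<in> module_hom R M N"
  shows "h \<zero>\<^bsub>M\<^esub> = \<zero>\<^bsub>N\<^esub>"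
proof -
  interpret M: left_module R M by fact
  interpret N: left_module R N by fact
  show ?thesis
    using module_homD(2)[OF assms(3), of "\<zero>\<^bsub>M\<^esub>" "\<zero>\<^bsub>M\<^esub>"] module_homD(1)[OF assms(3), of "\<zero>\<^bsub>M\<^esub>"]
    by simp
qed

lemma module_hom_comp:
  assumes "f \<in> module_hom R L M" "g \<in> module_hom R M N"
  shows "g \<circ> f \<in> module_hom R L N"
  using assms by (auto simp: module_hom_def Pi_def)

lemma module_iso_sym:
  assumes "left_module R M" "module_iso R M N"
  shows "module_iso R N M"
proof -
  interpret M: left_module R M by fact
  obtain h where h: "h \<in> module_hom R M N" "bij_betw h (carrier M) (carrier N)"
    using assms by (auto simp: module_iso_def)
  define k where "k = inv_into (carrier M) h"
  have k: "bij_betw k (carrier N) (carrier M)"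
    unfolding k_def using h by (simp add: bij_betw_inv_into)
  have kM: "k y \<in> carrier M" and hk: "h (k y) = y" if "y \<in> carrier N" for y
    using that k h by (auto simp: k_def bij_betw_def f_inv_into_f inv_into_into)
  have kh: "k (h x) = x" if "x \<in> carrier M" for x
    using that h by (simp add: k_def bij_betw_def)
  have "k (x \<oplus>\<^bsub>N\<^esub> y) = k x \<oplus>\<^bsub>M\<^esub> k y" if "x \<in> carrier N" "y \<in> carrier N" for x y
    using that kh[of "k x \<oplus>\<^bsub>M\<^esub> k y"] by (simp add: module_homD[OF h(1)] kM hk)
  moreover have "k (r \<odot>\<^bsub>N\<^esub> x) = r \<odot>\<^bsub>M\<^esub> k x" if "r \<in> carrier R" "x \<in> carrier N" for r x
    using that kh[of "r \<odot>\<^bsub>M\<^esub> k x"] by (simp add: module_homD[OF h(1)] kM hk)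
  ultimately have "k \<in> module_hom R N M" by (auto simp: module_hom_def kM)
  with k show ?thesis by (auto simp: module_iso_def)
qed

lemma module_iso_trans:
  assumes "module_iso R L M" "module_iso R M N"
  shows "module_iso R L N"
  using assms unfolding module_iso_def by (meson bij_betw_trans module_hom_comp)

lemma module_iso_direct_sum_cong:
  assumes "module_iso R M M'" "module_iso R N N'"
  shows "module_iso R (direct_sum M N) (direct_sum M' N')"
proof -
  obtain f g where f: "f \<in> module_hom R M M'" "bij_betw f (carrier M) (carrier M')"
    and g: "g \<in> module_hom R N N'" "bij_betw g (carrier N) (carrier N')"
    using assms by (auto simp: module_iso_def)
  have "map_prod f g \<in> module_hom R (direct_sum M N) (direct_sum M' N')"
    using f(1) g(1) by (auto simp: module_hom_def direct_sum_def)
  moreover have "bij_betw (map_prod f g) (carrier (direct_sum M N)) (carrier (direct_sum M' N'))"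
    using bij_betw_map_prod[OF f(2) g(2)] by (simp add: direct_sum_def)
  ultimately show ?thesis by (auto simp: module_iso_def)
qed

lemma direct_sum_simps:
  "carrier (direct_sum M N) = carrier M \<times> carrier N"
  "\<zero>\<^bsub>direct_sum M N\<^esub> = (\<zero>\<^bsub>M\<^esub>, \<zero>\<^bsub>N\<^esub>)"
  "(x, y) \<oplus>\<^bsub>direct_sum M N\<^esub> (x', y') = (x \<oplus>\<^bsub>M\<^esub> x', y \<oplus>\<^bsub>N\<^esub> y')"
  "r \<odot>\<^bsub>direct_sum M N\<^esub> (x, y) = (r \<odot>\<^bsub>M\<^esub> x, r \<odot>\<^bsub>N\<^esub> y)"
  by (simp_all add: direct_sum_def)

section \<open>The ring as a module over itself, and transport of module structure along a
  map\<close>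

definition regular_module :: "('r, 'x) ring_scheme \<Rightarrow> ('r, 'r) module" where
  "regular_module R = \<lparr>carrier = carrier R, mult = undefined, one = undefined,
     ring.zero = \<zero>\<^bsub>R\<^esub>, add = add R, smult = mult R\<rparr>"

lemma regular_module_simps [simp]:
  "carrier (regular_module R) = carrier R"
  "\<zero>\<^bsub>regular_module R\<^esub> = \<zero>\<^bsub>R\<^esub>"
  "x \<oplus>\<^bsub>regular_module R\<^esub> y = x \<oplus>\<^bsub>R\<^esub> y"
  "r \<odot>\<^bsub>regular_module R\<^esub> x = r \<otimes>\<^bsub>R\<^esub> x"
  by (simp_all add: regular_module_def)

lemma left_module_regular:
  assumes "ring R"
  shows "left_module R (regular_module R)"
proof -
  interpret ring R by fact
  have "abelian_group (regular_module R)"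
    by (rule abelian_groupI) (auto simp: a_ac intro: l_neg)
  then show ?thesis
    by (intro left_module.intro left_module_axioms.intro ring_axioms)
      (auto simp: l_distr r_distr m_assoc)
qed

text \<open>Operations are computed on representatives picked by \<open>inv_into\<close>. The one
  construction serves as a quotient, when \<open>h\<close> is a coset map, and as a relabelling of
  elements, when \<open>h\<close> is injective.\<close>

definition image_module :: "('a \<Rightarrow> 'b) \<Rightarrow> ('r, 'a) module \<Rightarrow> ('r, 'b) module" where
  "image_module h N = \<lparr>carrier = h ` carrier N, mult = undefined, one = undefined,
     ring.zero = h \<zero>\<^bsub>N\<^esub>,
     add = (\<lambda>a b. h (inv_into (carrier N) h a \<oplus>\<^bsub>N\<^esub> inv_into (carrier N) h b)),
     smult = (\<lambda>r a. h (r \<odot>\<^bsub>N\<^esub> inv_into (carrier N) h a))\<rparr>"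

text \<open>The assumptions make the fibres of \<open>h\<close> a congruence, so the chosen
  representatives do not matter. Compatibility in one summand suffices, because addition is
  commutative.\<close>

lemma image_module:
  fixes h :: "'a \<Rightarrow> 'b"
  assumes N: "left_module R N"
    and add: "\<And>x x' y. \<lbrakk>x \<in> carrier N; x' \<in> carrier N; y \<in> carrier N; h x = h x'\<rbrakk> \<Longrightarrow>
      h (x \<oplus>\<^bsub>N\<^esub> y) = h (x' \<oplus>\<^bsub>N\<^esub> y)"
    and smult: "\<And>r x x'. \<lbrakk>r \<in> carrier R; x \<in> carrier N; x' \<in> carrier N; h x = h x'\<rbrakk> \<Longrightarrow>
      h (r \<odot>\<^bsub>N\<^esub> x) = h (r \<odot>\<^bsub>N\<^esub> x')"
  shows "left_module R (image_module h N)" "h \<in> module_hom R N (image_module h N)"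
    "h ` carrier N = carrier (image_module h N)"
proof -
  interpret N: left_module R N by fact
  let ?Q = "image_module h N"
  have inv: "inv_into (carrier N) h (h x) \<in> carrier N" "h (inv_into (carrier N) h (h x)) = h x"
    if "x \<in> carrier N" for x
    using that by (auto intro: inv_into_into f_inv_into_f)
  have car: "carrier ?Q = h ` carrier N" and zero: "\<zero>\<^bsub>?Q\<^esub> = h \<zero>\<^bsub>N\<^esub>"
    by (simp_all add: image_module_def)
  have h_add: "h x \<oplus>\<^bsub>?Q\<^esub> h y = h (x \<oplus>\<^bsub>N\<^esub> y)" if "x \<in> carrier N" "y \<in> carrier N" for x y
  proof -
    let ?x = "inv_into (carrier N) h (h x)" and ?y = "inv_into (carrier N) h (h y)"
    have "h (?x \<oplus>\<^bsub>N\<^esub> ?y) = h (x \<oplus>\<^bsub>N\<^esub> ?y)"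
      using that inv by (intro add) auto
    also have "\<dots> = h (?y \<oplus>\<^bsub>N\<^esub> x)"
      using that inv by (simp add: N.M.a_comm)
    also have "\<dots> = h (y \<oplus>\<^bsub>N\<^esub> x)"
      using that inv by (intro add) auto
    finally show ?thesis
      using that by (simp add: image_module_def N.M.a_comm)
  qed
  have h_smult: "r \<odot>\<^bsub>?Q\<^esub> h x = h (r \<odot>\<^bsub>N\<^esub> x)" if "r \<in> carrier R" "x \<in> carrier N" for r x
    using that inv by (auto simp: image_module_def intro!: smult)
  have "abelian_group ?Q"
  proof (rule abelian_groupI)
    fix a assume "a \<in> carrier ?Q"
    then obtain x where "x \<in> carrier N" "a = h x" by (auto simp: car)
    then show "\<exists>b\<in>carrier ?Q. b \<oplus>\<^bsub>?Q\<^esub> a = \<zero>\<^bsub>?Q\<^esub>"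
      by (intro bexI[of _ "h (\<ominus>\<^bsub>N\<^esub> x)"]) (auto simp: car zero h_add N.M.l_neg)
  qed (auto simp: car zero h_add N.M.a_ac)
  then show "left_module R ?Q"
    by (intro left_module.intro left_module_axioms.intro N.R.ring_axioms)
      (auto simp: car h_add h_smult N.smult_l_distr N.smult_r_distr N.smult_assoc1)
  show "h \<in> module_hom R N ?Q"
    by (auto simp: module_hom_def car h_add h_smult)
  show "h ` carrier N = carrier ?Q" by (simp add: car)
qed

text \<open>The later constructions live on function, set and product types, whereas the final
  modules must have carriers in one prescribed type. Moving the structure along a bijection closes
  that gap.\<close>

lemma ex_isomorphic_module:
  assumes "left_module R N" "|carrier N| =o |C|"
  shows "\<exists>N' :: ('r, 'b) module. left_module R N' \<and> carrier N' = (C :: 'b set) \<and> module_iso R N N'"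
proof -
  obtain h where h: "bij_betw h (carrier N) C"
    using assms(2) card_of_ordIso by blast
  have inj: "x = x'" if "x \<in> carrier N" "x' \<in> carrier N" "h x = h x'" for x x'
    using that h by (auto simp: bij_betw_def inj_on_def)
  have im: "left_module R (image_module h N)" "h \<in> module_hom R N (image_module h N)"
    "h ` carrier N = carrier (image_module h N)"
    by (rule image_module[OF assms(1)]; metis inj)+
  with h show ?thesis
    unfolding module_iso_def by (intro exI[of _ "image_module h N"]) (auto simp: bij_betw_def)
qed

section \<open>Injectivity of all modules when left ideals have idempotent generators\<close>

text \<open>
  Baer's criterion in the special case where every left ideal is generated by an idempotent; any
  homomorphism from such an ideal is then right multiplication by an element.
\<close>

lemma extend_hom_of_idempotent_generators:
  fixes R :: "('r, 'x) ring_scheme" and B :: "('r, 'b) module" and N :: "('r, 'n) module"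
  assumes idem: "\<And>I. submodule I R (regular_module R) \<Longrightarrow> \<exists>e\<in>I. \<forall>r\<in>I. r \<otimes>\<^bsub>R\<^esub> e = r"
    and B: "left_module R B" and N: "left_module R N"
    and A: "submodule A R B" and f: "f \<in> module_hom R (B\<lparr>carrier := A\<rparr>) N"
  shows "\<exists>g\<in>module_hom R B N. \<forall>x\<in>A. g x = f x"
proof -
  interpret B: left_module R B by fact
  interpret N: left_module R N by fact
  interpret RR: left_module R "regular_module R"
    by (rule left_module_regular) (rule B.R.ring_axioms)
  let ?D = "direct_sum B N"
  interpret D: left_module R ?D by (rule left_module_direct_sum) fact+
  note A' = submoduleD[OF A]
  have fA: "f x \<in> carrier N" if "x \<in> A" for x
    using that f by (auto simp: module_hom_def)
  have f_add: "f (x \<oplus>\<^bsub>B\<^esub> y) = f x \<oplus>\<^bsub>N\<^esub> f y" if "x \<in> A" "y \<in> A" for x y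
    using that f by (auto simp: module_hom_def)
  have f_smult: "f (r \<odot>\<^bsub>B\<^esub> x) = r \<odot>\<^bsub>N\<^esub> f x" if "r \<in> carrier R" "x \<in> A" for r x
    using that f by (auto simp: module_hom_def)
  have f0: "f \<zero>\<^bsub>B\<^esub> = \<zero>\<^bsub>N\<^esub>"
    using f_add[of "\<zero>\<^bsub>B\<^esub>" "\<zero>\<^bsub>B\<^esub>"] A' fA by simp
  \<comment> \<open>Partial extensions of \<open>f\<close>, represented by their graphs.\<close>
  define \<G> where "\<G> = {G. submodule G R ?D \<and> (\<forall>x\<in>A. (x, f x) \<in> G) \<and>
    (\<forall>y. (\<zero>\<^bsub>B\<^esub>, y) \<in> G \<longrightarrow> y = \<zero>\<^bsub>N\<^esub>)}"
  have "(\<lambda>x. (x, f x)) ` A \<in> \<G>"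
  proof -
    have "submodule ((\<lambda>x. (x, f x)) ` A) R ?D"
      using A' by (intro D.submoduleI)
        (auto simp: direct_sum_simps image_iff fA f_add f_smult f0 subsetD)
    then show ?thesis by (auto simp: \<G>_def f0)
  qed
  moreover have "\<Union>\<C> \<in> \<G>" if ne: "\<C> \<noteq> {}" and ch: "subset.chain \<G> \<C>" for \<C>
  proof -
    have sub: "submodule G R ?D" if "G \<in> \<C>" for G
      using that ch by (auto simp: subset.chain_def \<G>_def)
    obtain G0 where G0: "G0 \<in> \<C>" using ne by auto
    have "submodule (\<Union>\<C>) R ?D"
    proof (rule D.submoduleI)
      fix x y assume "x \<in> \<Union>\<C>" "y \<in> \<Union>\<C>"
      then obtain G H where GH: "G \<in> \<C>" "x \<in> G" "H \<in> \<C>" "y \<in> H" by auto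
      then have "G \<subseteq> H \<or> H \<subseteq> G" using ch by (auto simp: subset_chain_def)
      then show "x \<oplus>\<^bsub>?D\<^esub> y \<in> \<Union>\<C>"
        using GH submoduleD(3)[OF sub[of G]] submoduleD(3)[OF sub[of H]] by blast
    next
      show "\<Union>\<C> \<subseteq> carrier ?D" using submoduleD(1)[OF sub] by blast
      show "\<zero>\<^bsub>?D\<^esub> \<in> \<Union>\<C>" using submoduleD(2)[OF sub] G0 by blast
    next
      fix a x assume "a \<in> carrier R" "x \<in> \<Union>\<C>"
      then show "a \<odot>\<^bsub>?D\<^esub> x \<in> \<Union>\<C>" using submoduleD(5)[OF sub] by blast
    qed
    then show ?thesis using G0 ch by (auto simp: subset.chain_def \<G>_def)
  qed
  ultimately obtain G where G: "G \<in> \<G>" and max: "\<And>H. H \<in> \<G> \<Longrightarrow> G \<subseteq> H \<Longrightarrow> H = G"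
    using subset_Zorn_nonempty[of \<G>] by blast
  have Gsub: "submodule G R ?D" and fG: "\<And>x. x \<in> A \<Longrightarrow> (x, f x) \<in> G"
    and G0: "\<And>y. (\<zero>\<^bsub>B\<^esub>, y) \<in> G \<Longrightarrow> y = \<zero>\<^bsub>N\<^esub>"
    using G by (auto simp: \<G>_def)
  note G' = submoduleD[OF Gsub]
  have GB: "x \<in> carrier B" "y \<in> carrier N" if "(x, y) \<in> G" for x y
    using that G'(1) by (auto simp: direct_sum_simps)
  \<comment> \<open>Subtracting two pairs over the same \<open>x\<close> reduces single-valuedness
    to the condition on pairs over zero.\<close>
  have uniq: "y = y'" if y: "(x, y) \<in> G" "(x, y') \<in> G" for x y y'
  proof -
    have "(\<ominus>\<^bsub>R\<^esub> \<one>\<^bsub>R\<^esub>) \<odot>\<^bsub>?D\<^esub> (x, y') \<in> G" using y G'(5) by simp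
    then have "(\<ominus>\<^bsub>B\<^esub> x, \<ominus>\<^bsub>N\<^esub> y') \<in> G"
      using GB[OF y(2)] by (simp add: direct_sum_simps B.smult_l_minus N.smult_l_minus)
    from G'(3)[OF y(1) this] have "(\<zero>\<^bsub>B\<^esub>, y \<oplus>\<^bsub>N\<^esub> \<ominus>\<^bsub>N\<^esub> y') \<in> G"
      using GB[OF y(1)] by (simp add: direct_sum_simps B.M.r_neg)
    from G0[OF this] show ?thesis
      using GB[OF y(1)] GB[OF y(2)] by (metis N.M.minus_equality N.M.minus_minus N.M.a_inv_closed)
  qed
  have total: "\<exists>y. (b, y) \<in> G" if b: "b \<in> carrier B" for b
  proof -
    \<comment> \<open>\<open>I\<close> is the left ideal of scalars that move \<open>b\<close> into
      the domain of the maximal partial extension.\<close>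
    define I where "I = {r \<in> carrier R. \<exists>y. (r \<odot>\<^bsub>B\<^esub> b, y) \<in> G}"
    have "submodule I R (regular_module R)"
    proof (rule RR.submoduleI)
      show "\<zero>\<^bsub>regular_module R\<^esub> \<in> I"
        using b G'(2) by (auto simp: I_def direct_sum_simps)
    next
      fix r s assume "r \<in> I" "s \<in> I"
      then show "r \<oplus>\<^bsub>regular_module R\<^esub> s \<in> I"
        using b G'(3) by (fastforce simp: I_def direct_sum_simps B.smult_l_distr)
    next
      fix a r assume "a \<in> carrier R" "r \<in> I"
      then show "a \<odot>\<^bsub>regular_module R\<^esub> r \<in> I"
        using b G'(5) by (fastforce simp: I_def direct_sum_simps B.smult_assoc1)
    qed (auto simp: I_def)
    then obtain e where e: "e \<in> I" "\<And>r. r \<in> I \<Longrightarrow> r \<otimes>\<^bsub>R\<^esub> e = r"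
      using idem by blast
    \<comment> \<open>The value at \<open>e b\<close> is a legitimate value at \<open>b\<close>
      itself: for \<open>r\<close> in \<open>I\<close> one has \<open>r b = r (e b)\<close>, so
      \<open>r n\<close> is already the value at \<open>r b\<close>.\<close>
    then obtain n where n: "(e \<odot>\<^bsub>B\<^esub> b, n) \<in> G" and eR: "e \<in> carrier R"
      by (auto simp: I_def)
    have nN: "n \<in> carrier N" using GB n by blast
    \<comment> \<open>\<open>H\<close> is the submodule generated by \<open>G\<close> and the new
      pair \<open>(b, n)\<close>.\<close>
    define H where "H = {(x \<oplus>\<^bsub>B\<^esub> r \<odot>\<^bsub>B\<^esub> b, y \<oplus>\<^bsub>N\<^esub> r \<odot>\<^bsub>N\<^esub> n) | x y r. (x, y) \<in> G \<and> r \<in> carrier R}"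
    have HI: "(x \<oplus>\<^bsub>B\<^esub> r \<odot>\<^bsub>B\<^esub> b, y \<oplus>\<^bsub>N\<^esub> r \<odot>\<^bsub>N\<^esub> n) \<in> H" if "(x, y) \<in> G" "r \<in> carrier R" for x y r
      using that by (auto simp: H_def)
    have GH: "G \<subseteq> H"
    proof
      fix p assume "p \<in> G"
      then show "p \<in> H"
        using HI[of "fst p" "snd p" "\<zero>\<^bsub>R\<^esub>"] GB[of "fst p" "snd p"] b nN by simp
    qed
    have "submodule H R ?D"
    proof (rule D.submoduleI)
      show "H \<subseteq> carrier ?D"
        using b nN GB by (auto simp: H_def direct_sum_simps)
      show "\<zero>\<^bsub>?D\<^esub> \<in> H" using GH G'(2) by auto
    next
      fix p q assume "p \<in> H" "q \<in> H"
      then obtain x y r x' y' r' where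
        p: "p = (x \<oplus>\<^bsub>B\<^esub> r \<odot>\<^bsub>B\<^esub> b, y \<oplus>\<^bsub>N\<^esub> r \<odot>\<^bsub>N\<^esub> n)" "(x, y) \<in> G" "r \<in> carrier R" and
        q: "q = (x' \<oplus>\<^bsub>B\<^esub> r' \<odot>\<^bsub>B\<^esub> b, y' \<oplus>\<^bsub>N\<^esub> r' \<odot>\<^bsub>N\<^esub> n)" "(x', y') \<in> G" "r' \<in> carrier R"
        by (auto simp: H_def)
      have "(x \<oplus>\<^bsub>B\<^esub> x', y \<oplus>\<^bsub>N\<^esub> y') \<in> G"
        using G'(3)[OF p(2) q(2)] by (simp add: direct_sum_simps)
      from HI[OF this, of "r \<oplus>\<^bsub>R\<^esub> r'"] show "p \<oplus>\<^bsub>?D\<^esub> q \<in> H"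
        using p q b nN GB[OF p(2)] GB[OF q(2)]
        by (simp add: direct_sum_simps B.smult_l_distr N.smult_l_distr B.M.a_ac N.M.a_ac)
    next
      fix a p assume a: "a \<in> carrier R" and "p \<in> H"
      then obtain x y r where
        p: "p = (x \<oplus>\<^bsub>B\<^esub> r \<odot>\<^bsub>B\<^esub> b, y \<oplus>\<^bsub>N\<^esub> r \<odot>\<^bsub>N\<^esub> n)" "(x, y) \<in> G" "r \<in> carrier R"
        by (auto simp: H_def)
      have "(a \<odot>\<^bsub>B\<^esub> x, a \<odot>\<^bsub>N\<^esub> y) \<in> G"
        using G'(5)[OF a p(2)] by (simp add: direct_sum_simps)
      from HI[OF this, of "a \<otimes>\<^bsub>R\<^esub> r"] show "a \<odot>\<^bsub>?D\<^esub> p \<in> H"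
        using a p b nN GB[OF p(2)]
        by (simp add: direct_sum_simps B.smult_r_distr N.smult_r_distr B.smult_assoc1 N.smult_assoc1)
    qed
    \<comment> \<open>From \<open>x + r b = 0\<close> it follows that \<open>-r\<close> lies in
      \<open>I\<close>, hence \<open>x = -r (e b)\<close>, over which \<open>G\<close> has the value
      \<open>-r n\<close>. So \<open>y = -r n\<close>, and \<open>z\<close> vanishes.\<close>
    moreover have "z = \<zero>\<^bsub>N\<^esub>" if z: "(\<zero>\<^bsub>B\<^esub>, z) \<in> H" for z
    proof -
      obtain x y r where xy: "\<zero>\<^bsub>B\<^esub> = x \<oplus>\<^bsub>B\<^esub> r \<odot>\<^bsub>B\<^esub> b" "z = y \<oplus>\<^bsub>N\<^esub> r \<odot>\<^bsub>N\<^esub> n"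
        and G: "(x, y) \<in> G" and r: "r \<in> carrier R"
        using z by (auto simp: H_def)
      have x: "x = (\<ominus>\<^bsub>R\<^esub> r) \<odot>\<^bsub>B\<^esub> b"
        using xy(1) GB[OF G] r b by (metis B.M.minus_equality B.smult_closed B.smult_l_minus)
      with G r have "\<ominus>\<^bsub>R\<^esub> r \<in> I" by (auto simp: I_def)
      from e(2)[OF this] have "x = (\<ominus>\<^bsub>R\<^esub> r) \<odot>\<^bsub>B\<^esub> (e \<odot>\<^bsub>B\<^esub> b)"
        using x r eR b by (metis B.R.a_inv_closed B.smult_assoc1)
      then have "(x, (\<ominus>\<^bsub>R\<^esub> r) \<odot>\<^bsub>N\<^esub> n) \<in> G"
        using G'(5)[OF _ n, of "\<ominus>\<^bsub>R\<^esub> r"] r by (simp add: direct_sum_simps)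
      with G have "y = (\<ominus>\<^bsub>R\<^esub> r) \<odot>\<^bsub>N\<^esub> n" by (rule uniq)
      then show ?thesis
        using xy(2) r nN by (simp add: N.smult_l_minus N.M.l_neg)
    qed
    ultimately have "H \<in> \<G>" using GH fG by (auto simp: \<G>_def)
    \<comment> \<open>Maximality forces the pair \<open>(b, n)\<close> into \<open>G\<close>, so the
      domain of \<open>G\<close> is all of \<open>B\<close>.\<close>
    with GH have "H = G" using max by blast
    moreover have "(b, n) \<in> H"
      using HI[of "\<zero>\<^bsub>B\<^esub>" "\<zero>\<^bsub>N\<^esub>" "\<one>\<^bsub>R\<^esub>"] G'(2) b nN by (simp add: direct_sum_simps)
    ultimately show ?thesis by blast
  qed
  define g where "g x = (THE y. (x, y) \<in> G)" for x
  have gI: "g x = y" if "(x, y) \<in> G" for x y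
    unfolding g_def using that uniq by (intro the_equality) auto
  have gG: "(x, g x) \<in> G" if "x \<in> carrier B" for x
    using total[OF that] gI by auto
  have "g \<in> module_hom R B N"
    unfolding module_hom_def
  proof (intro CollectI conjI ballI funcsetI)
    fix x assume "x \<in> carrier B"
    then show "g x \<in> carrier N" using gG GB by blast
  next
    fix x y assume "x \<in> carrier B" "y \<in> carrier B"
    then show "g (x \<oplus>\<^bsub>B\<^esub> y) = g x \<oplus>\<^bsub>N\<^esub> g y"
      using G'(3)[OF gG gG, of x y] by (intro gI) (simp add: direct_sum_simps)
  next
    fix r x assume "r \<in> carrier R" "x \<in> carrier B"
    then show "g (r \<odot>\<^bsub>B\<^esub> x) = r \<odot>\<^bsub>N\<^esub> g x"
      using G'(5)[OF _ gG, of r x] by (intro gI) (simp add: direct_sum_simps)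
  qed
  moreover have "\<forall>x\<in>A. g x = f x" using fG gI by blast
  ultimately show ?thesis by blast
qed

text \<open>Every module turns out to be injective, so homomorphisms from pure submodules extend in
  particular. The theorem uses the contrapositive, which supplies a left ideal without such a
  generator.\<close>

lemma left_pure_semisimple_of_idempotent_generators:
  assumes "\<And>I. submodule I R (regular_module R) \<Longrightarrow> \<exists>e\<in>I. \<forall>r\<in>I. r \<otimes>\<^bsub>R\<^esub> e = r"
  shows "left_pure_semisimple TYPE('n) TYPE('b) R"
  unfolding left_pure_semisimple_def pure_injective_def
  using extend_hom_of_idempotent_generators[OF assms] by (auto simp: pure_submodule_def)

section \<open>Direct sums of copies of a module, free modules and their projectivity\<close>

text \<open>The direct sum of copies of \<open>N\<close> indexed by \<open>X\<close>. Elements are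
  total functions vanishing off \<open>X\<close>, so that equality of elements is equality of
  functions. For the regular module this is the free module on \<open>X\<close>.\<close>

definition finsupp_module :: "'a set \<Rightarrow> ('r, 'n) module \<Rightarrow> ('r, 'a \<Rightarrow> 'n) module" where
  "finsupp_module X N = \<lparr>carrier = {f. (\<forall>x. f x \<in> carrier N) \<and>
       {x. f x \<noteq> \<zero>\<^bsub>N\<^esub>} \<subseteq> X \<and> finite {x. f x \<noteq> \<zero>\<^bsub>N\<^esub>}},
     mult = undefined, one = undefined, ring.zero = (\<lambda>x. \<zero>\<^bsub>N\<^esub>),
     add = (\<lambda>f g x. f x \<oplus>\<^bsub>N\<^esub> g x), smult = (\<lambda>r f x. r \<odot>\<^bsub>N\<^esub> f x)\<rparr>"

lemma finsupp_module_simps: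
  "carrier (finsupp_module X N) = {f. (\<forall>x. f x \<in> carrier N) \<and>
       {x. f x \<noteq> \<zero>\<^bsub>N\<^esub>} \<subseteq> X \<and> finite {x. f x \<noteq> \<zero>\<^bsub>N\<^esub>}}"
  "\<zero>\<^bsub>finsupp_module X N\<^esub> = (\<lambda>x. \<zero>\<^bsub>N\<^esub>)"
  "f \<oplus>\<^bsub>finsupp_module X N\<^esub> g = (\<lambda>x. f x \<oplus>\<^bsub>N\<^esub> g x)"
  "r \<odot>\<^bsub>finsupp_module X N\<^esub> f = (\<lambda>x. r \<odot>\<^bsub>N\<^esub> f x)"
  by (simp_all add: finsupp_module_def)

lemma left_module_finsupp:
  assumes "left_module R N"
  shows "left_module R (finsupp_module X N)"
proof -
  interpret N: left_module R N by fact
  let ?F = "finsupp_module X N"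
  have closed: "f \<oplus>\<^bsub>?F\<^esub> g \<in> carrier ?F" if "f \<in> carrier ?F" "g \<in> carrier ?F" for f g
  proof -
    have "{x. f x \<oplus>\<^bsub>N\<^esub> g x \<noteq> \<zero>\<^bsub>N\<^esub>} \<subseteq> {x. f x \<noteq> \<zero>\<^bsub>N\<^esub>} \<union> {x. g x \<noteq> \<zero>\<^bsub>N\<^esub>}"
      by auto
    with that show ?thesis
      by (auto simp: finsupp_module_simps elim: finite_subset)
  qed
  have smult_closed: "r \<odot>\<^bsub>?F\<^esub> f \<in> carrier ?F" if "r \<in> carrier R" "f \<in> carrier ?F" for r f
  proof -
    have "{x. r \<odot>\<^bsub>N\<^esub> f x \<noteq> \<zero>\<^bsub>N\<^esub>} \<subseteq> {x. f x \<noteq> \<zero>\<^bsub>N\<^esub>}"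
      using that by auto
    with that show ?thesis
      by (auto simp: finsupp_module_simps elim: finite_subset)
  qed
  have "abelian_group ?F"
  proof (rule abelian_groupI)
    fix f assume "f \<in> carrier ?F"
    \<comment> \<open>Writing the negative as a multiple by -1 lets closure under scalars provide
      its finite support.\<close>
    moreover from this have "(\<ominus>\<^bsub>R\<^esub> \<one>\<^bsub>R\<^esub>) \<odot>\<^bsub>?F\<^esub> f \<in> carrier ?F"
      by (intro smult_closed) auto
    ultimately show "\<exists>g\<in>carrier ?F. g \<oplus>\<^bsub>?F\<^esub> f = \<zero>\<^bsub>?F\<^esub>"
      by (intro bexI[of _ "(\<ominus>\<^bsub>R\<^esub> \<one>\<^bsub>R\<^esub>) \<odot>\<^bsub>?F\<^esub> f"])
        (auto simp: finsupp_module_simps N.smult_l_minus N.M.l_neg)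
  qed (auto simp: closed, auto simp: finsupp_module_simps N.M.a_ac)
  then show ?thesis
    by (intro left_module.intro left_module_axioms.intro N.R.ring_axioms smult_closed)
      (auto simp: finsupp_module_simps N.smult_l_distr N.smult_r_distr N.smult_assoc1)
qed

definition finsupp_single :: "('r, 'n) module \<Rightarrow> 'a \<Rightarrow> 'n \<Rightarrow> 'a \<Rightarrow> 'n" where
  "finsupp_single N x a = (\<lambda>y. if y = x then a else \<zero>\<^bsub>N\<^esub>)"

lemma finsupp_single_in_carrier:
  assumes "left_module R N" "x \<in> X" "a \<in> carrier N"
  shows "finsupp_single N x a \<in> carrier (finsupp_module X N)"
proof -
  interpret N: left_module R N by fact
  have "{y. finsupp_single N x a y \<noteq> \<zero>\<^bsub>N\<^esub>} \<subseteq> {x}"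
    by (auto simp: finsupp_single_def)
  with assms show ?thesis
    by (auto simp: finsupp_module_simps elim: finite_subset) (auto simp: finsupp_single_def)
qed

text \<open>The elements with a single entry generate the module additively.\<close>

lemma finsupp_hom_eqI:
  assumes N: "left_module R N" and P: "left_module R P"
    and g: "g \<in> module_hom R (finsupp_module X N) P" and h: "h \<in> module_hom R (finsupp_module X N) P"
    and eq: "\<And>x a. \<lbrakk>x \<in> X; a \<in> carrier N\<rbrakk> \<Longrightarrow> g (finsupp_single N x a) = h (finsupp_single N x a)"
    and f: "f \<in> carrier (finsupp_module X N)"
  shows "g f = h f"
proof -
  interpret N: left_module R N by fact
  interpret F: left_module R "finsupp_module X N" by (rule left_module_finsupp) fact
  let ?F = "finsupp_module X N"
  \<comment> \<open>The induction is over a finite set \<open>S\<close> that merely contains the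
    support, so an entry that is already zero can be skipped and a nonzero one split off.\<close>
  have "g f = h f" if "finite S" "{x. f x \<noteq> \<zero>\<^bsub>N\<^esub>} \<subseteq> S" "f \<in> carrier ?F" for S f
    using that
  proof (induction S arbitrary: f rule: finite_induct)
    case empty
    then have "f = \<zero>\<^bsub>?F\<^esub>" by (auto simp: finsupp_module_simps)
    then show ?case
      using module_hom_zero[OF F.left_module_axioms P g] module_hom_zero[OF F.left_module_axioms P h]
      by simp
  next
    case (insert x S)
    show ?case
    proof (cases "f x = \<zero>\<^bsub>N\<^esub>")
      case True
      then show ?thesis using insert by (intro insert.IH) auto
    next
      case False
      define f' where "f' = f(x := \<zero>\<^bsub>N\<^esub>)"
      have supp: "{y. f' y \<noteq> \<zero>\<^bsub>N\<^esub>} \<subseteq> {y. f y \<noteq> \<zero>\<^bsub>N\<^esub>}"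
        by (auto simp: f'_def)
      have f': "f' \<in> carrier ?F"
        using insert.prems finite_subset[OF supp] supp
        by (auto simp: finsupp_module_simps) (auto simp: f'_def)
      have x: "x \<in> X" "f x \<in> carrier N"
        using insert.prems False by (auto simp: finsupp_module_simps)
      have f: "f = f' \<oplus>\<^bsub>?F\<^esub> finsupp_single N x (f x)"
        using insert.prems x by (auto simp: finsupp_module_simps f'_def finsupp_single_def)
      have s: "finsupp_single N x (f x) \<in> carrier ?F"
        by (rule finsupp_single_in_carrier) fact+
      have "{y. f' y \<noteq> \<zero>\<^bsub>N\<^esub>} \<subseteq> S"
        using insert.prems(1) by (auto simp: f'_def)
      then have "g f' = h f'"
        using f' by (rule insert.IH)
      then have "g (f' \<oplus>\<^bsub>?F\<^esub> finsupp_single N x (f x)) = h (f' \<oplus>\<^bsub>?F\<^esub> finsupp_single N x (f x))"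
        by (simp add: module_homD(2)[OF g f' s] module_homD(2)[OF h f' s] eq[OF x])
      then show ?thesis by (subst (1 2) f)
    qed
  qed
  from this[OF _ order_refl f] show ?thesis
    using f by (simp add: finsupp_module_simps)
qed

lemma (in left_module) finsum_smult_rdistr:
  assumes "finite A" "a \<in> carrier R" "f \<in> A \<rightarrow> carrier M"
  shows "a \<odot>\<^bsub>M\<^esub> (\<Oplus>\<^bsub>M\<^esub>i\<in>A. f i) = (\<Oplus>\<^bsub>M\<^esub>i\<in>A. a \<odot>\<^bsub>M\<^esub> f i)"
  using assms
proof (induction A rule: finite_induct)
  case (insert x A)
  then show ?case by (simp add: Pi_def smult_r_distr)
qed simp

text \<open>The existence half of the universal property of a free module: \<open>p\<close>
  prescribes the images of the basis, and \<open>g\<close> forms the corresponding linear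
  combinations.\<close>

lemma free_module_hom_ex:
  fixes R :: "('r, 'x) ring_scheme" and X :: "'a set"
  assumes P: "left_module R P" and p: "\<And>x. x \<in> X \<Longrightarrow> p x \<in> carrier P"
  shows "\<exists>g \<in> module_hom R (finsupp_module X (regular_module R)) P.
    \<forall>x\<in>X. \<forall>a\<in>carrier R. g (finsupp_single (regular_module R) x a) = a \<odot>\<^bsub>P\<^esub> p x"
proof -
  interpret P: left_module R P by fact
  let ?RR = "regular_module R"
  let ?F = "finsupp_module X ?RR"
  interpret RR: left_module R ?RR
    by (rule left_module_regular) (rule P.R.ring_axioms)
  interpret F: left_module R ?F by (rule left_module_finsupp) (rule RR.left_module_axioms)
  define supp where "supp f = {x. f x \<noteq> \<zero>\<^bsub>R\<^esub>}" for f :: "'a \<Rightarrow> 'r"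
  define g where "g f = (\<Oplus>\<^bsub>P\<^esub>x\<in>supp f. f x \<odot>\<^bsub>P\<^esub> p x)" for f
  have F: "f x \<in> carrier R" "supp f \<subseteq> X" "finite (supp f)"
    "x \<in> supp f \<Longrightarrow> p x \<in> carrier P" if "f \<in> carrier ?F" for f x
    using that p by (auto simp: finsupp_module_simps supp_def)
  \<comment> \<open>Any finite set between the support and \<open>X\<close> gives the same sum.
    Additivity needs this freedom, since two functions and their sum may have three different
    supports.\<close>
  have g: "g f = (\<Oplus>\<^bsub>P\<^esub>x\<in>S. f x \<odot>\<^bsub>P\<^esub> p x)"
    if "f \<in> carrier ?F" "finite S" "S \<subseteq> X" "supp f \<subseteq> S" for f S
    unfolding g_def using that F[OF that(1)] p
    by (intro P.M.add.finprod_mono_neutral_cong_left) (auto simp: supp_def)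
  have "g \<in> module_hom R ?F P"
    unfolding module_hom_def
  proof (intro CollectI conjI ballI funcsetI)
    fix f assume "f \<in> carrier ?F"
    then show "g f \<in> carrier P"
      unfolding g_def using F by (intro P.M.finsum_closed) blast
  next
    fix f f' assume f: "f \<in> carrier ?F" "f' \<in> carrier ?F"
    define S where "S = supp f \<union> supp f'"
    have "supp (f \<oplus>\<^bsub>?F\<^esub> f') \<subseteq> S"
      by (auto simp: finsupp_module_simps supp_def S_def)
    then have "g (f \<oplus>\<^bsub>?F\<^esub> f') = (\<Oplus>\<^bsub>P\<^esub>x\<in>S. (f \<oplus>\<^bsub>?F\<^esub> f') x \<odot>\<^bsub>P\<^esub> p x)"
      using f F[OF f(1)] F[OF f(2)] by (intro g) (auto simp: S_def)
    also have "\<dots> = (\<Oplus>\<^bsub>P\<^esub>x\<in>S. f x \<odot>\<^bsub>P\<^esub> p x \<oplus>\<^bsub>P\<^esub> f' x \<odot>\<^bsub>P\<^esub> p x)"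
      using F[OF f(1)] F[OF f(2)]
      by (intro P.M.finsum_cong) (auto simp: finsupp_module_simps S_def P.smult_l_distr simp_implies_def)
    also have "\<dots> = (\<Oplus>\<^bsub>P\<^esub>x\<in>S. f x \<odot>\<^bsub>P\<^esub> p x) \<oplus>\<^bsub>P\<^esub> (\<Oplus>\<^bsub>P\<^esub>x\<in>S. f' x \<odot>\<^bsub>P\<^esub> p x)"
      using F[OF f(1)] F[OF f(2)] by (intro P.M.finsum_addf) (auto simp: S_def)
    also have "\<dots> = g f \<oplus>\<^bsub>P\<^esub> g f'"
      using f F[OF f(1)] F[OF f(2)] by (subst (1 2) g[of _ S]) (auto simp: S_def)
    finally show "g (f \<oplus>\<^bsub>?F\<^esub> f') = g f \<oplus>\<^bsub>P\<^esub> g f'" .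
  next
    fix r f assume r: "r \<in> carrier R" and f: "f \<in> carrier ?F"
    have "g (r \<odot>\<^bsub>?F\<^esub> f) = (\<Oplus>\<^bsub>P\<^esub>x\<in>supp f. (r \<odot>\<^bsub>?F\<^esub> f) x \<odot>\<^bsub>P\<^esub> p x)"
      using r f F[OF f] by (intro g F.smult_closed) (auto simp: finsupp_module_simps(4) supp_def)
    also have "\<dots> = (\<Oplus>\<^bsub>P\<^esub>x\<in>supp f. r \<odot>\<^bsub>P\<^esub> (f x \<odot>\<^bsub>P\<^esub> p x))"
      using r F[OF f]
      by (intro P.M.finsum_cong) (auto simp: finsupp_module_simps(4) P.smult_assoc1 simp_implies_def)
    also have "\<dots> = r \<odot>\<^bsub>P\<^esub> g f"
      unfolding g_def using r F[OF f] by (intro P.finsum_smult_rdistr[symmetric]) auto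
    finally show "g (r \<odot>\<^bsub>?F\<^esub> f) = r \<odot>\<^bsub>P\<^esub> g f" .
  qed
  moreover have "g (finsupp_single ?RR x a) = a \<odot>\<^bsub>P\<^esub> p x" if x: "x \<in> X" and a: "a \<in> carrier R" for x a
  proof -
    have "g (finsupp_single ?RR x a) = (\<Oplus>\<^bsub>P\<^esub>y\<in>{x}. finsupp_single ?RR x a y \<odot>\<^bsub>P\<^esub> p y)"
      using x a by (intro g finsupp_single_in_carrier[OF RR.left_module_axioms])
        (auto simp: supp_def finsupp_single_def)
    then show ?thesis
      using x a p by (simp add: finsupp_single_def)
  qed
  ultimately show ?thesis by blast
qed

text \<open>Each basis element is sent to a preimage under \<open>h\<close> of its image under
  \<open>\<psi>\<close>. The extension to a homomorphism lifts \<open>\<psi>\<close> because both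
  maps agree on elements with a single entry.\<close>

lemma free_module_projective:
  assumes P: "left_module R P" and N: "left_module R N"
    and h: "h \<in> module_hom R P N" "h ` carrier P = carrier N"
    and \<psi>: "\<psi> \<in> module_hom R (finsupp_module X (regular_module R)) N"
  shows "\<exists>g \<in> module_hom R (finsupp_module X (regular_module R)) P.
    \<forall>f\<in>carrier (finsupp_module X (regular_module R)). h (g f) = \<psi> f"
proof -
  interpret P: left_module R P by fact
  let ?RR = "regular_module R"
  let ?F = "finsupp_module X ?RR"
  let ?e = "\<lambda>x. finsupp_single ?RR x \<one>\<^bsub>R\<^esub>"
  interpret RR: left_module R ?RR
    by (rule left_module_regular) (rule P.R.ring_axioms)
  have e: "?e x \<in> carrier ?F" if "x \<in> X" for x
    using that by (intro finsupp_single_in_carrier[OF RR.left_module_axioms]) auto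
  have "\<exists>p. p \<in> carrier P \<and> h p = \<psi> (?e x)" if "x \<in> X" for x
    using module_homD(1)[OF \<psi> e[OF that]] h(2) by (metis imageE)
  then obtain p where p: "\<And>x. x \<in> X \<Longrightarrow> p x \<in> carrier P" "\<And>x. x \<in> X \<Longrightarrow> h (p x) = \<psi> (?e x)"
    by metis
  obtain g where g: "g \<in> module_hom R ?F P"
    and gp: "\<And>x a. \<lbrakk>x \<in> X; a \<in> carrier R\<rbrakk> \<Longrightarrow> g (finsupp_single ?RR x a) = a \<odot>\<^bsub>P\<^esub> p x"
    using free_module_hom_ex[OF P, of X p] p(1) by blast
  have "(h \<circ> g) f = \<psi> f" if f: "f \<in> carrier ?F" for f
  proof (rule finsupp_hom_eqI[OF RR.left_module_axioms N module_hom_comp[OF g h(1)] \<psi> _ f])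
    fix x a assume x: "x \<in> X" and "a \<in> carrier ?RR"
    then have a: "a \<in> carrier R" by simp
    have "finsupp_single ?RR x a = a \<odot>\<^bsub>?F\<^esub> ?e x"
      using a by (auto simp: finsupp_module_simps finsupp_single_def)
    then have "\<psi> (finsupp_single ?RR x a) = a \<odot>\<^bsub>N\<^esub> h (p x)"
      using module_homD(3)[OF \<psi> a e[OF x]] p(2)[OF x] by simp
    then show "(h \<circ> g) (finsupp_single ?RR x a) = \<psi> (finsupp_single ?RR x a)"
      using x a p(1) by (simp add: gp module_homD(3)[OF h(1)])
  qed
  with g show ?thesis by auto
qed

section \<open>Cyclic quotients of the ring, and their splitting off from free modules\<close>

definition ideal_coset :: "('r, 'x) ring_scheme \<Rightarrow> 'r set \<Rightarrow> 'r \<Rightarrow> 'r set" where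
  "ideal_coset R I r = {s \<in> carrier R. s \<ominus>\<^bsub>R\<^esub> r \<in> I}"

text \<open>For a left ideal \<open>I\<close>, that is, a submodule of the regular module, this is
  the quotient \<open>R/I\<close>, obtained as the image of the map that sends \<open>r\<close> to
  the coset \<open>r + I\<close>.\<close>

abbreviation cyclic_module :: "('r, 'x) ring_scheme \<Rightarrow> 'r set \<Rightarrow> ('r, 'r set) module" where
  "cyclic_module R I \<equiv> image_module (ideal_coset R I) (regular_module R)"

lemma ideal_coset_eq_iff:
  assumes "ring R" "submodule I R (regular_module R)" "r \<in> carrier R" "s \<in> carrier R"
  shows "ideal_coset R I r = ideal_coset R I s \<longleftrightarrow> r \<ominus>\<^bsub>R\<^esub> s \<in> I"
proof -
  interpret ring R by fact
  interpret RR: left_module R "regular_module R" by (rule left_module_regular) fact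
  note I = submoduleD[OF assms(2), simplified]
  have neg: "\<ominus>\<^bsub>R\<^esub> x \<in> I" if "x \<in> I" for x
    using I(5)[of "\<ominus>\<^bsub>R\<^esub> \<one>\<^bsub>R\<^esub>" x] that I(1) by (auto simp: l_minus)
  have neg: "s \<ominus>\<^bsub>R\<^esub> r \<in> I" if "r \<ominus>\<^bsub>R\<^esub> s \<in> I" "r \<in> carrier R" "s \<in> carrier R" for r s
    using neg[OF that(1)] that(2,3) by (simp add: minus_eq minus_add a_comm)
  have sub: "ideal_coset R I r \<subseteq> ideal_coset R I s"
    if "r \<ominus>\<^bsub>R\<^esub> s \<in> I" "r \<in> carrier R" "s \<in> carrier R" for r s
  proof
    fix x assume "x \<in> ideal_coset R I r"
    then have x: "x \<in> carrier R" "x \<ominus>\<^bsub>R\<^esub> r \<in> I" by (auto simp: ideal_coset_def)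
    have "(x \<ominus>\<^bsub>R\<^esub> r) \<oplus>\<^bsub>R\<^esub> (r \<ominus>\<^bsub>R\<^esub> s) = x \<ominus>\<^bsub>R\<^esub> s"
      using x(1) that(2,3) by (simp add: minus_eq a_assoc r_neg1)
    then show "x \<in> ideal_coset R I s"
      using I(3)[OF x(2) that(1)] x(1) by (simp add: ideal_coset_def)
  qed
  show ?thesis
  proof
    assume "ideal_coset R I r = ideal_coset R I s"
    moreover have "r \<in> ideal_coset R I r"
      using assms I by (simp add: ideal_coset_def minus_eq r_neg)
    ultimately show "r \<ominus>\<^bsub>R\<^esub> s \<in> I"
      by (simp add: ideal_coset_def)
  next
    assume "r \<ominus>\<^bsub>R\<^esub> s \<in> I"
    then show "ideal_coset R I r = ideal_coset R I s"
      using sub[of r s] sub[of s r] neg[of r s] assms by blast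
  qed
qed

text \<open>Cosets are compatible with the operations: a common summand cancels from a difference,
  and a left factor \<open>r\<close> multiplies the difference, which stays in the left
  ideal.\<close>

lemma cyclic_module:
  assumes R: "ring R" and I: "submodule I R (regular_module R)"
  shows "left_module R (cyclic_module R I)"
    "ideal_coset R I \<in> module_hom R (regular_module R) (cyclic_module R I)"
    "ideal_coset R I ` carrier R = carrier (cyclic_module R I)"
proof -
  interpret ring R by fact
  note I' = submoduleD[OF I, simplified]
  note iff = ideal_coset_eq_iff[OF R I]
  have add: "ideal_coset R I (x \<oplus>\<^bsub>R\<^esub> y) = ideal_coset R I (x' \<oplus>\<^bsub>R\<^esub> y)"
    if "x \<in> carrier R" "x' \<in> carrier R" "y \<in> carrier R" "ideal_coset R I x = ideal_coset R I x'" for x x' y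
  proof -
    have "(x \<oplus>\<^bsub>R\<^esub> y) \<ominus>\<^bsub>R\<^esub> (x' \<oplus>\<^bsub>R\<^esub> y) = x \<ominus>\<^bsub>R\<^esub> x'"
      using that(1-3) by (simp add: minus_eq a_comm[of x' y] minus_add a_assoc r_neg2)
    then show ?thesis using that by (simp add: iff)
  qed
  have smult: "ideal_coset R I (r \<otimes>\<^bsub>R\<^esub> x) = ideal_coset R I (r \<otimes>\<^bsub>R\<^esub> x')"
    if "r \<in> carrier R" "x \<in> carrier R" "x' \<in> carrier R" "ideal_coset R I x = ideal_coset R I x'" for r x x'
  proof -
    have "r \<otimes>\<^bsub>R\<^esub> x \<ominus>\<^bsub>R\<^esub> r \<otimes>\<^bsub>R\<^esub> x' = r \<otimes>\<^bsub>R\<^esub> (x \<ominus>\<^bsub>R\<^esub> x')"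
      using that(1-3) by (simp add: minus_eq r_distr r_minus)
    then show ?thesis using that I'(5) by (simp add: iff)
  qed
  show "left_module R (cyclic_module R I)"
    "ideal_coset R I \<in> module_hom R (regular_module R) (cyclic_module R I)"
    "ideal_coset R I ` carrier R = carrier (cyclic_module R I)"
    by (rule image_module[OF left_module_regular[OF R], of "ideal_coset R I", simplified, OF add smult];
        assumption)+
qed

text \<open>A direct summand of a free module is projective, so the coset map from \<open>R\<close>
  to \<open>R/I\<close> splits. Let \<open>u\<close> be the value of the splitting at the coset of
  1. Then \<open>I\<close> annihilates \<open>u\<close> from the left and \<open>1 - u\<close> lies
  in \<open>I\<close>, so \<open>e = 1 - u\<close> works.\<close>

lemma idempotent_generator_of_summand:
  assumes R: "ring R" and I: "submodule I R (regular_module R)"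
    and K: "left_module R K"
    and iso: "module_iso R (finsupp_module X (regular_module R)) (direct_sum (cyclic_module R I) K)"
  shows "\<exists>e\<in>I. \<forall>r\<in>I. r \<otimes>\<^bsub>R\<^esub> e = r"
proof -
  interpret ring R by fact
  let ?RR = "regular_module R" and ?Q = "cyclic_module R I" and ?h = "ideal_coset R I"
  let ?F = "finsupp_module X ?RR"
  interpret RR: left_module R ?RR by (rule left_module_regular) fact
  interpret F: left_module R ?F by (rule left_module_finsupp) (rule RR.left_module_axioms)
  interpret K: left_module R K by fact
  note Q = cyclic_module[OF R I]
  note I' = submoduleD[OF I, simplified]
  obtain \<phi> where \<phi>: "\<phi> \<in> module_hom R ?F (direct_sum ?Q K)"
    "bij_betw \<phi> (carrier ?F) (carrier (direct_sum ?Q K))"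
    using iso by (auto simp: module_iso_def)
  have "fst \<in> module_hom R (direct_sum ?Q K) ?Q"
    by (auto simp: module_hom_def direct_sum_simps)
  \<comment> \<open>\<open>g\<close> lifts the projection of the free module onto \<open>R/I\<close>
    through the coset map.\<close>
  from module_hom_comp[OF \<phi>(1) this] obtain g where g: "g \<in> module_hom R ?F ?RR"
    "\<And>f. f \<in> carrier ?F \<Longrightarrow> ?h (g f) = fst (\<phi> f)"
    using free_module_projective[OF RR.left_module_axioms Q(1,2), of "fst \<circ> \<phi>" X] Q(3) by auto
  have h1: "?h \<one>\<^bsub>R\<^esub> \<in> carrier ?Q" using Q(3) by blast
  \<comment> \<open>The element \<open>f\<close> is the coset of 1, embedded in the first summand
    and pulled back to the free module.\<close>
  have "(?h \<one>\<^bsub>R\<^esub>, \<zero>\<^bsub>K\<^esub>) \<in> \<phi> ` carrier ?F"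
    using \<phi>(2) h1 by (simp add: bij_betw_def direct_sum_simps)
  then obtain f where f: "f \<in> carrier ?F" "\<phi> f = (?h \<one>\<^bsub>R\<^esub>, \<zero>\<^bsub>K\<^esub>)"
    by (metis imageE)
  define u where "u = g f"
  have u: "u \<in> carrier R" "?h \<one>\<^bsub>R\<^esub> = ?h u"
    using module_homD(1)[OF g(1) f(1)] g(2)[OF f(1)] f(2) by (simp_all add: u_def)
  \<comment> \<open>An element of \<open>I\<close> kills the coset of 1, hence kills
    \<open>f\<close> by injectivity of \<open>\<phi>\<close>, and hence kills
    \<open>u = g f\<close>.\<close>
  have ann: "r \<otimes>\<^bsub>R\<^esub> u = \<zero>\<^bsub>R\<^esub>" if r: "r \<in> I" for r
  proof -
    have rR: "r \<in> carrier R" using r I' by blast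
    have "?h r = ?h \<zero>\<^bsub>R\<^esub>"
      using ideal_coset_eq_iff[OF R I rR, of "\<zero>\<^bsub>R\<^esub>"] r rR by (simp add: minus_eq)
    also have "\<dots> = \<zero>\<^bsub>?Q\<^esub>"
      using module_hom_zero[OF RR.left_module_axioms Q(1,2)] by simp
    finally have "r \<odot>\<^bsub>?Q\<^esub> ?h \<one>\<^bsub>R\<^esub> = \<zero>\<^bsub>?Q\<^esub>"
      using module_homD(3)[OF Q(2) rR, of "\<one>\<^bsub>R\<^esub>"] rR by simp
    then have "\<phi> (r \<odot>\<^bsub>?F\<^esub> f) = \<phi> \<zero>\<^bsub>?F\<^esub>"
      using module_homD(3)[OF \<phi>(1) rR f(1)] f(2) rR
        module_hom_zero[OF F.left_module_axioms left_module_direct_sum[OF Q(1) K] \<phi>(1)]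
      by (simp add: direct_sum_simps)
    then have "r \<odot>\<^bsub>?F\<^esub> f = \<zero>\<^bsub>?F\<^esub>"
      using \<phi>(2) f(1) rR by (auto simp: bij_betw_def dest: inj_onD)
    then show ?thesis
      using module_homD(3)[OF g(1) rR f(1)]
        module_hom_zero[OF F.left_module_axioms RR.left_module_axioms g(1)]
      by (simp add: u_def)
  qed
  have "\<one>\<^bsub>R\<^esub> \<ominus>\<^bsub>R\<^esub> u \<in> I"
    using ideal_coset_eq_iff[OF R I, of "\<one>\<^bsub>R\<^esub>" u] u by simp
  moreover have "r \<otimes>\<^bsub>R\<^esub> (\<one>\<^bsub>R\<^esub> \<ominus>\<^bsub>R\<^esub> u) = r" if r: "r \<in> I" for r
  proof -
    have rR: "r \<in> carrier R" using r I' by blast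
    then have "r \<otimes>\<^bsub>R\<^esub> (\<one>\<^bsub>R\<^esub> \<ominus>\<^bsub>R\<^esub> u) = r \<ominus>\<^bsub>R\<^esub> r \<otimes>\<^bsub>R\<^esub> u"
      using u(1) by (simp add: minus_eq r_distr r_minus)
    then show ?thesis using ann[OF r] rR by (simp add: minus_eq)
  qed
  ultimately show ?thesis by blast
qed

section \<open>The Eilenberg swindle\<close>

text \<open>A sequence amounts to its entry at 0 together with its shift. The entry removed from the
  countable sum of copies of \<open>Q\<close> joins the second copy of \<open>F\<close>, and what
  remains is again an arbitrary element of that countable sum.\<close>

lemma module_iso_shift:
  fixes Q :: "('r, 'q) module" and F :: "('r, 'f) module"
  assumes "left_module R Q"
  shows "module_iso R (direct_sum (direct_sum (finsupp_module (UNIV :: nat set) Q) F) F)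
    (direct_sum (direct_sum (finsupp_module (UNIV :: nat set) Q) F) (direct_sum Q F))"
proof -
  interpret Q: left_module R Q by fact
  let ?N = "finsupp_module (UNIV :: nat set) Q"
  define sh where "sh q = (\<lambda>n. q (Suc n))" for q :: "nat \<Rightarrow> 'q"
  define un where "un a q = case_nat a q" for a :: 'q and q
  have sh_un: "sh (un a q) = q" and un_sh: "un (q 0) (sh q) = q" and un_0: "un a q 0 = a" for a q
    by (auto simp: sh_def un_def fun_eq_iff split: nat.split)
  have val: "q 0 \<in> carrier Q" if "q \<in> carrier ?N" for q
    using that by (simp add: finsupp_module_simps)
  have sh: "sh q \<in> carrier ?N" if "q \<in> carrier ?N" for q
  proof -
    have "finite (Suc -` {n. q n \<noteq> \<zero>\<^bsub>Q\<^esub>})"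
      using that by (intro finite_vimageI) (auto simp: finsupp_module_simps)
    with that show ?thesis by (simp add: finsupp_module_simps vimage_def sh_def)
  qed
  have un: "un a q \<in> carrier ?N" if "q \<in> carrier ?N" "a \<in> carrier Q" for q a
  proof -
    have "{n. un a q n \<noteq> \<zero>\<^bsub>Q\<^esub>} \<subseteq> insert 0 (Suc ` {n. q n \<noteq> \<zero>\<^bsub>Q\<^esub>})"
      by (force simp: un_def split: nat.splits)
    moreover have "finite (insert 0 (Suc ` {n. q n \<noteq> \<zero>\<^bsub>Q\<^esub>}))"
      using that by (simp add: finsupp_module_simps)
    ultimately have "finite {n. un a q n \<noteq> \<zero>\<^bsub>Q\<^esub>}"
      by (rule finite_subset)
    with that show ?thesis
      by (simp add: finsupp_module_simps un_def split: nat.split)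
  qed
  have sh_add: "sh (q \<oplus>\<^bsub>?N\<^esub> q') = sh q \<oplus>\<^bsub>?N\<^esub> sh q'" "(q \<oplus>\<^bsub>?N\<^esub> q') 0 = q 0 \<oplus>\<^bsub>Q\<^esub> q' 0"
    and sh_smult: "sh (r \<odot>\<^bsub>?N\<^esub> q) = r \<odot>\<^bsub>?N\<^esub> sh q" "(r \<odot>\<^bsub>?N\<^esub> q) 0 = r \<odot>\<^bsub>Q\<^esub> q 0" for q q' r
    by (simp_all add: finsupp_module_simps sh_def)
  define h where "h = (\<lambda>((q, f :: 'f), f' :: 'f). ((sh q, f), (q 0, f')))"
  define k where "k = (\<lambda>((q, f :: 'f), (a, f' :: 'f)). ((un a q, f), f'))"
  let ?A = "direct_sum (direct_sum ?N F) F" and ?B = "direct_sum (direct_sum ?N F) (direct_sum Q F)"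
  have "h \<in> carrier ?A \<rightarrow> carrier ?B"
    by (auto simp: h_def direct_sum_simps sh val)
  moreover have "h (x \<oplus>\<^bsub>?A\<^esub> y) = h x \<oplus>\<^bsub>?B\<^esub> h y" for x y
    by (cases x; cases y) (auto simp: h_def direct_sum_simps sh_add split: prod.split)
  moreover have "h (r \<odot>\<^bsub>?A\<^esub> x) = r \<odot>\<^bsub>?B\<^esub> h x" for r x
    by (cases x) (auto simp: h_def direct_sum_simps sh_smult split: prod.split)
  ultimately have "h \<in> module_hom R ?A ?B"
    by (simp add: module_hom_def)
  moreover have "bij_betw h (carrier ?A) (carrier ?B)"
    by (rule bij_betw_byWitness[where f' = k])
      (auto simp: h_def k_def direct_sum_simps sh un val sh_un un_sh un_0)
  ultimately show ?thesis by (auto simp: module_iso_def)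
qed

section \<open>Cardinalities of the modules, and infinity of the power\<close>

text \<open>A finitely supported function is determined by its graph over the support, a finite
  subset of \<open>X \<times> carrier N\<close>. An infinite set has as many finite subsets as
  elements.\<close>

lemma card_of_finsupp_ordLeq:
  assumes L: "infinite L" and X: "|X| \<le>o |L|" and N: "|carrier N| \<le>o |L|"
  shows "|carrier (finsupp_module X N)| \<le>o |L|"
proof -
  \<comment> \<open>The larger set has the form to which \<open>lepoll_restricted_funspace\<close>
    applies.\<close>
  have "carrier (finsupp_module X N) \<subseteq>
      {f. f ` X \<subseteq> carrier N \<and> {x. f x \<noteq> \<zero>\<^bsub>N\<^esub>} \<subseteq> X \<and> finite {x. f x \<noteq> \<zero>\<^bsub>N\<^esub>}}"
    by (auto simp: finsupp_module_simps)
  then have "carrier (finsupp_module X N) \<lesssim> Fpow (X \<times> carrier N)"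
    by (rule lepoll_trans[OF subset_imp_lepoll lepoll_restricted_funspace])
  also have "Fpow (X \<times> carrier N) \<lesssim> Fpow L"
  proof -
    have "|X \<times> carrier N| \<le>o |L|"
      using assms by (rule card_of_Times_ordLeq_infinite)
    then obtain j where "inj_on j (X \<times> carrier N)" "j ` (X \<times> carrier N) \<subseteq> L"
      unfolding card_of_ordLeq[symmetric] by blast
    then show ?thesis
      unfolding lepoll_def
      by (intro exI[of _ "image j"] conjI inj_on_image_Fpow image_Fpow_mono)
  qed
  also have "Fpow L \<lesssim> L" using L by (simp add: eqpoll_Fpow eqpoll_imp_lepoll)
  finally show ?thesis by (simp add: lepoll_def card_of_ordLeq)
qed

text \<open>The basis gives the lower bound, its elements being distinct because \<open>1\<close>
  differs from \<open>0\<close>. Counting finitely supported functions gives the upper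
  bound.\<close>

lemma card_of_free_module:
  assumes "ring R" "\<one>\<^bsub>R\<^esub> \<noteq> \<zero>\<^bsub>R\<^esub>" "infinite X" "|carrier R| \<le>o |X|"
  shows "|carrier (finsupp_module X (regular_module R))| =o |X|"
proof -
  interpret RR: left_module R "regular_module R" by (rule left_module_regular) fact
  let ?e = "\<lambda>x. finsupp_single (regular_module R) x \<one>\<^bsub>R\<^esub>"
  have "inj_on ?e X"
    using assms(2) by (auto intro!: inj_onI simp: finsupp_single_def fun_eq_iff split: if_splits)
  moreover have "?e ` X \<subseteq> carrier (finsupp_module X (regular_module R))"
    by (auto intro: finsupp_single_in_carrier[OF RR.left_module_axioms])
  ultimately have "|X| \<le>o |carrier (finsupp_module X (regular_module R))|"
    by (metis card_of_ordLeq)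
  moreover have "|carrier (finsupp_module X (regular_module R))| \<le>o |X|"
    using assms by (intro card_of_finsupp_ordLeq) auto
  ultimately show ?thesis by (simp add: ordIso_iff_ordLeq)
qed

lemma card_of_direct_sum:
  assumes K: "left_module R K" "|carrier K| \<le>o |L|" and F: "|carrier F| =o |L|" and L: "infinite L"
  shows "|carrier (direct_sum K F)| =o |L|"
proof -
  interpret K: left_module R K by fact
  have "infinite (carrier F)" using F L card_of_ordIso_finite by blast
  moreover have "|carrier K| \<le>o |carrier F|"
    using K(2) ordIso_symmetric[OF F] by (rule ordLeq_ordIso_trans)
  ultimately have "|carrier K \<times> carrier F| =o |carrier F|"
    using card_of_Times_infinite[of "carrier F" "carrier K"] K.M.zero_closed by blast
  from ordIso_transitive[OF this F] show ?thesis by (simp add: direct_sum_simps)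
qed

text \<open>This excludes the degenerate case of at most one element in \<open>Field mu\<close>,
  where the power is finite. Two elements of \<open>A\<close> yield two different sequences in
  \<open>Field mu\<close>, hence two different values there, from which infinitely many sequences
  can be formed.\<close>

lemma infinite_cexp_natLeq:
  assumes ab: "a \<in> A" "b \<in> A" "a \<noteq> b" and A: "|A| \<le>o mu ^c natLeq"
  shows "infinite (Field (mu ^c natLeq))"
proof -
  have Field: "Field (mu ^c natLeq) = Func UNIV (Field mu)"
    by (simp add: cexp_def Field_card_of Field_natLeq)
  have "|A| \<le>o |Func (UNIV :: nat set) (Field mu)|"
    using A by (simp add: cexp_def Field_natLeq)
  then obtain j where "inj_on j A" "j ` A \<subseteq> Func (UNIV :: nat set) (Field mu)"
    by (metis card_of_ordLeq)
  then have j: "j a \<noteq> j b" "\<And>n. j a n \<in> Field mu" "\<And>n. j b n \<in> Field mu"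
    using ab by (auto simp: inj_on_def Func_def)
  then obtain n where n: "j a n \<noteq> j b n" by (auto simp: fun_eq_iff)
  \<comment> \<open>The sequence \<open>s k\<close> departs from the constant value
    \<open>j b n\<close> exactly at position \<open>k\<close>.\<close>
  define s where "s k = (\<lambda>m :: nat. if m = k then j a n else j b n)" for k
  have "inj s"
    using n by (auto intro!: injI simp: s_def fun_eq_iff split: if_splits)
  moreover have "range s \<subseteq> Field (mu ^c natLeq)"
    using j by (auto simp: Field Func_def s_def)
  ultimately show ?thesis by (metis infinite_iff_countable_subset)
qed

section \<open>Choice of the left ideal, and assembly of the modules on a set of size
  \<open>lam\<close>\<close>

theorem theorem0p4:
  fixes R :: "('r, 'x) ring_scheme"
    and lam :: "'l rel"
    and mu :: "'u rel"
  assumes "ring R"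
    and "\<not> left_pure_semisimple TYPE('n) TYPE('b) R"
    and "Card_order lam"
    and "regularCard lam"
    and "|carrier R| <o lam"
    and "Card_order mu"
    and "lam =o cardSuc (mu ^c natLeq)"
  shows "\<exists>(M :: ('r, 'l) module) (M1 :: ('r, 'l) module) (M2 :: ('r, 'l) module).
    left_module R M \<and> left_module R M1 \<and> left_module R M2 \<and>
    |carrier M| =o lam \<and> |carrier M1| =o lam \<and> |carrier M2| =o lam \<and>
    module_iso R (direct_sum M M1) (direct_sum M M2) \<and>
    \<not> module_iso R M1 M2"
proof -
  interpret R: ring R by fact
  let ?RR = "regular_module R"
  interpret RR: left_module R ?RR by (rule left_module_regular) fact
  obtain I where I: "submodule I R ?RR" and no_idem: "\<not> (\<exists>e\<in>I. \<forall>r\<in>I. r \<otimes>\<^bsub>R\<^esub> e = r)"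
    using assms(2) left_pure_semisimple_of_idempotent_generators[of R, where ?'n = 'n and ?'b = 'b] by metis
  note I' = submoduleD[OF I, simplified]
  \<comment> \<open>Over the zero ring \<open>I\<close> would be the zero ideal, which has a
    generator of the excluded kind. Two distinct scalars are needed both for the size of the free
    module and for the infinity of \<open>lam\<close>.\<close>
  have one: "\<one>\<^bsub>R\<^esub> \<noteq> \<zero>\<^bsub>R\<^esub>"
  proof
    assume "\<one>\<^bsub>R\<^esub> = \<zero>\<^bsub>R\<^esub>"
    then have "carrier R = {\<zero>\<^bsub>R\<^esub>}" by (rule R.one_zeroD)
    with I'(1,2) have "I = {\<zero>\<^bsub>R\<^esub>}" by auto
    with no_idem show False by simp
  qed
  \<comment> \<open>\<open>L\<close> serves twice: it indexes the basis of the free module and is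
    the common carrier of the final modules.\<close>
  define L where "L = Field lam"
  have lam: "|L| =o lam" using assms(3) by (simp add: L_def card_of_Field_ordIso)
  have "|carrier R| <o cardSuc (mu ^c natLeq)"
    using assms(5,7) by (rule ordLess_ordIso_trans)
  \<comment> \<open>Below a successor cardinal means at most its predecessor. A ring with two
    elements then forces that predecessor to be infinite.\<close>
  then have "|carrier R| \<le>o mu ^c natLeq"
    by (simp add: Card_order_cexp)
  then have "infinite (Field (mu ^c natLeq))"
    using one by (intro infinite_cexp_natLeq[of "\<one>\<^bsub>R\<^esub>" "carrier R" "\<zero>\<^bsub>R\<^esub>"]) auto
  then have "infinite (Field (cardSuc (mu ^c natLeq)))"
    by (simp add: Card_order_cexp)
  then have L: "infinite L"
    using card_of_ordIso_finite_Field[OF assms(3), of "Field (cardSuc (mu ^c natLeq))"]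
      ordIso_transitive[OF assms(7) ordIso_symmetric[OF card_of_Field_ordIso]]
    by (simp add: L_def Card_order_cexp cardSuc_Card_order)
  have R_L: "|carrier R| \<le>o |L|"
    by (rule ordLeq_ordIso_trans[OF ordLess_imp_ordLeq[OF assms(5)] ordIso_symmetric[OF lam]])
  define F where "F = finsupp_module L ?RR"
  define Q where "Q = cyclic_module R I"
  define N where "N = finsupp_module (UNIV :: nat set) Q"
  have F: "left_module R F" unfolding F_def by (rule left_module_finsupp) (rule RR.left_module_axioms)
  have Q: "left_module R Q" unfolding Q_def by (rule cyclic_module(1)) fact+
  have N: "left_module R N" unfolding N_def by (rule left_module_finsupp) fact
  have cF: "|carrier F| =o |L|"
    unfolding F_def using assms(1) one L R_L by (rule card_of_free_module)
  have Q_L: "|carrier Q| \<le>o |L|"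
    unfolding Q_def cyclic_module(3)[OF assms(1) I, symmetric]
    by (rule ordLeq_transitive[OF card_of_image R_L])
  have N_L: "|carrier N| \<le>o |L|"
    unfolding N_def using L Q_L by (intro card_of_finsupp_ordLeq) (auto simp: infinite_iff_card_of_nat)
  have cM: "|carrier (direct_sum N F)| =o |L|" and cQF: "|carrier (direct_sum Q F)| =o |L|"
    using card_of_direct_sum N N_L Q Q_L cF L by blast+
  \<comment> \<open>The three modules all have the cardinality of \<open>L\<close>, so each is
    copied onto \<open>L\<close> itself and thereby into the type \<open>'l\<close>.\<close>
  obtain M :: "('r, 'l) module" where M: "left_module R M" "carrier M = L" "module_iso R (direct_sum N F) M"
    using ex_isomorphic_module[OF left_module_direct_sum[OF N F] cM] by blast
  obtain M1 :: "('r, 'l) module" where M1: "left_module R M1" "carrier M1 = L" "module_iso R F M1"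
    using ex_isomorphic_module[OF F cF] by blast
  obtain M2 :: "('r, 'l) module" where M2: "left_module R M2" "carrier M2 = L" "module_iso R (direct_sum Q F) M2"
    using ex_isomorphic_module[OF left_module_direct_sum[OF Q F] cQF] by blast
  have "module_iso R (direct_sum M M1) (direct_sum (direct_sum N F) F)"
    by (rule module_iso_sym) (auto intro: left_module_direct_sum module_iso_direct_sum_cong N F M M1)
  moreover have "module_iso R (direct_sum (direct_sum N F) F) (direct_sum (direct_sum N F) (direct_sum Q F))"
    unfolding N_def using Q by (rule module_iso_shift)
  moreover have "module_iso R (direct_sum (direct_sum N F) (direct_sum Q F)) (direct_sum M M2)"
    using M(3) M2(3) by (rule module_iso_direct_sum_cong)
  ultimately have "module_iso R (direct_sum M M1) (direct_sum M M2)"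
    by (blast intro: module_iso_trans)
  moreover have "\<not> module_iso R M1 M2"
  proof
    assume "module_iso R M1 M2"
    with M1(3) have "module_iso R F M2" by (rule module_iso_trans)
    moreover have "module_iso R M2 (direct_sum Q F)"
      by (rule module_iso_sym[OF _ M2(3)]) (rule left_module_direct_sum[OF Q F])
    \<comment> \<open>Now \<open>R/I\<close> is a summand of the free module \<open>F\<close>, with
      \<open>F\<close> itself as the complement, which gives \<open>I\<close> the generator it was
      chosen to lack.\<close>
    ultimately have "module_iso R F (direct_sum Q F)" by (rule module_iso_trans)
    then show False
      using no_idem idempotent_generator_of_summand[OF assms(1) I F, of L] unfolding F_def Q_def by blast
  qed
  ultimately show ?thesis
    using M(1,2) M1(1,2) M2(1,2) lam by (intro exI[of _ M] exI[of _ M1] exI[of _ M2]) simp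
qed

end
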